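(* Let $G$ be a finitely generated group and let $H\le G$ be a finitely generated subgroup. Then $H$ is profinitely rigid in $G$ if and only if both of the following hold: (i) $H$ is setwise profinitely rigid in $G$; (ii) $\mathrm{MP}_G(H)=\operatorname{im}\rho_H$.
   Context: For a finitely generated group $G$, a finitely generated subgroup $H\le G$, a finite group $K$ and $h\in\mathrm{Hom}(H,K)$, put $\Pr_{H,K}(h)=|\{f\in\mathrm{Hom}(G,K): f|_H=h\}|/|\mathrm{Hom}(G,K)|$. An isomorphism $\alpha\colon H_1\to H_2$ between finitely generated subgroups of $G$ is a measure equivalence (relative to $G$) if $\Pr_{H_2,K}(h)=\Pr_{H_1,K}(h\circ\alpha)$ for every finite group $K$ and every $h\in\mathrm{Hom}(H_2,K)$; $H_1,H_2$ are measure equivalent if such an $\alpha$ exists. $H$ is profinitely rigid in $G$ if, whenever $L\le G$ is finitely generated and $\alpha\colon H\to L$ is a measure equivalence, there exists $\varphi\in\mathrm{Aut}(G)$ with $\varphi(H)=L$ and $\varphi|_H=\alpha$. $H$ is setwise profinitely rigid in $G$ if every finitely generated $L\le G$ measure equivalent to $H$ is of the form $L=\varphi(H)$ for some $\varphi\in\mathrm{Aut}(G)$. $\mathrm{MP}_G(H)$ denotes the group of all $\gamma\in\mathrm{Aut}(H)$ that are measure equivalences $H\to H$. Let $\mathrm{Stab}_{\mathrm{Aut}(G)}(H)=\{\psi\in\mathrm{Aut}(G):\psi(H)=H\}$ and let $\rho_H\colon\mathrm{Stab}_{\mathrm{Aut}(G)}(H)\to\mathrm{Aut}(H)$, $\psi\mapsto\psi|_H$.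 *)

theory Defs
  imports Complex_Main "HOL-Algebra.Bij" "HOL-Algebra.Generated_Groups"
begin

definition finitely_generated :: "('a, 'm) monoid_scheme \<Rightarrow> bool" where
  "finitely_generated G \<longleftrightarrow> (\<exists>S. finite S \<and> S \<subseteq> carrier G \<and> generate G S = carrier G)"

definition fg_subgroup :: "'a set \<Rightarrow> ('a, 'm) monoid_scheme \<Rightarrow> bool" where
  "fg_subgroup H G \<longleftrightarrow> subgroup H G \<and> finitely_generated (G\<lparr>carrier := H\<rparr>)"

text \<open>
  The library sets \<^const>\<open>hom\<close> and \<^const>\<open>iso\<close> leave the values outside the carrier
  arbitrary. Counting homomorphisms and equating restrictions need each map to be
  represented exactly once, hence the restriction to extensional functions, as is done for
  automorphisms in \<^const>\<open>auto\<close>.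
\<close>

definition Hom :: "('a, 'm) monoid_scheme \<Rightarrow> ('b, 'n) monoid_scheme \<Rightarrow> ('a \<Rightarrow> 'b) set" where
  "Hom G K = hom G K \<inter> extensional (carrier G)"

definition Iso :: "('a, 'm) monoid_scheme \<Rightarrow> ('b, 'n) monoid_scheme \<Rightarrow> ('a \<Rightarrow> 'b) set" where
  "Iso G K = iso G K \<inter> extensional (carrier G)"

definition Pr ::
  "('a, 'm) monoid_scheme \<Rightarrow> 'a set \<Rightarrow> ('b, 'n) monoid_scheme \<Rightarrow> ('a \<Rightarrow> 'b) \<Rightarrow> real" where
  "Pr G H K h = real (card {f \<in> Hom G K. restrict f H = h}) / real (card (Hom G K))"

text \<open>
  A definition cannot quantify over types, so the finite groups \<open>K\<close> are taken with carrier a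
  finite set of natural numbers; up to isomorphism these are all finite groups. Lemma
  \<open>measure_equivalence_all_finite_groups\<close> below recovers the condition for finite groups over
  an arbitrary type. The composite of \<open>h\<close> and \<open>\<alpha>\<close> is taken in extensional form, by
  \<^const>\<open>compose\<close>.
\<close>

definition measure_equivalence ::
  "('a, 'm) monoid_scheme \<Rightarrow> 'a set \<Rightarrow> 'a set \<Rightarrow> ('a \<Rightarrow> 'a) \<Rightarrow> bool" where
  "measure_equivalence G H1 H2 \<alpha> \<longleftrightarrow>
     fg_subgroup H1 G \<and> fg_subgroup H2 G \<and>
     \<alpha> \<in> Iso (G\<lparr>carrier := H1\<rparr>) (G\<lparr>carrier := H2\<rparr>) \<and>
     (\<forall>K :: nat monoid. group K \<and> finite (carrier K) \<longrightarrow>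
        (\<forall>h \<in> Hom (G\<lparr>carrier := H2\<rparr>) K. Pr G H2 K h = Pr G H1 K (compose H1 h \<alpha>)))"

definition measure_equivalent ::
  "('a, 'm) monoid_scheme \<Rightarrow> 'a set \<Rightarrow> 'a set \<Rightarrow> bool" where
  "measure_equivalent G H1 H2 \<longleftrightarrow> (\<exists>\<alpha>. measure_equivalence G H1 H2 \<alpha>)"

definition profinitely_rigid :: "('a, 'm) monoid_scheme \<Rightarrow> 'a set \<Rightarrow> bool" where
  "profinitely_rigid G H \<longleftrightarrow>
     (\<forall>L \<alpha>. fg_subgroup L G \<and> measure_equivalence G H L \<alpha> \<longrightarrow>
        (\<exists>\<phi> \<in> auto G. \<phi> ` H = L \<and> restrict \<phi> H = \<alpha>))"

definition setwise_profinitely_rigid :: "('a, 'm) monoid_scheme \<Rightarrow> 'a set \<Rightarrow> bool" where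
  "setwise_profinitely_rigid G H \<longleftrightarrow>
     (\<forall>L. fg_subgroup L G \<and> measure_equivalent G L H \<longrightarrow> (\<exists>\<phi> \<in> auto G. L = \<phi> ` H))"

definition MP :: "('a, 'm) monoid_scheme \<Rightarrow> 'a set \<Rightarrow> ('a \<Rightarrow> 'a) set" where
  "MP G H = {\<gamma> \<in> auto (G\<lparr>carrier := H\<rparr>). measure_equivalence G H H \<gamma>}"

definition Stab :: "('a, 'm) monoid_scheme \<Rightarrow> 'a set \<Rightarrow> ('a \<Rightarrow> 'a) set" where
  "Stab G H = {\<psi> \<in> auto G. \<psi> ` H = H}"

definition rho :: "'a set \<Rightarrow> ('a \<Rightarrow> 'a) \<Rightarrow> ('a \<Rightarrow> 'a)" where
  "rho H \<psi> = restrict \<psi> H"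

lemma Hom_compose:
  assumes "group G" "f \<in> Hom G K" "b \<in> hom K K'"
  shows "compose (carrier G) b f \<in> Hom G K'"
proof -
  interpret group G by fact
  show ?thesis using assms(2,3) by (auto simp: Hom_def hom_def compose_def Pi_iff)
qed

lemma Pr_iso:
  assumes G: "group G" and K: "group K" and H: "H \<subseteq> carrier G"
    and b: "b \<in> iso K K'" and h: "h \<in> H \<rightarrow> carrier K" "h \<in> extensional H"
  shows "Pr G H K' (compose H b h) = Pr G H K h"
proof -
  let ?F = "compose (carrier G) b"
  let ?c = "inv_into (carrier K) b"
  have bh: "b \<in> hom K K'" and bb: "bij_betw b (carrier K) (carrier K')"
    using b by (auto simp: iso_def)
  have c: "?c \<in> hom K' K"
    using group.iso_set_sym[OF K b] by (auto simp: iso_def)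
  have inj: "inj_on b (carrier K)" using bb by (simp add: bij_betw_def)
  have injF: "inj_on ?F (Hom G K)"
  proof (rule inj_onI)
    fix f g assume f: "f \<in> Hom G K" and g: "g \<in> Hom G K" and e: "?F f = ?F g"
    show "f = g"
    proof (rule extensionalityI[of _ "carrier G"])
      show "f \<in> extensional (carrier G)" "g \<in> extensional (carrier G)"
        using f g by (auto simp: Hom_def)
      fix x assume x: "x \<in> carrier G"
      have "b (f x) = b (g x)" using fun_cong[OF e, of x] x by (simp add: compose_def)
      moreover have "f x \<in> carrier K" "g x \<in> carrier K"
        using f g x by (auto simp: Hom_def hom_def)
      ultimately show "f x = g x" using inj by (auto dest: inj_onD)
    qed
  qed
  have surj: "?F ` Hom G K = Hom G K'"
  proof
    show "?F ` Hom G K \<subseteq> Hom G K'" using Hom_compose[OF G _ bh] by auto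
    show "Hom G K' \<subseteq> ?F ` Hom G K"
    proof
      fix f assume f: "f \<in> Hom G K'"
      have "?F (compose (carrier G) ?c f) = f"
      proof (rule extensionalityI[of _ "carrier G"])
        show "f \<in> extensional (carrier G)" using f by (auto simp: Hom_def)
        fix x assume x: "x \<in> carrier G"
        then have "f x \<in> carrier K'" using f by (auto simp: Hom_def hom_def)
        then show "?F (compose (carrier G) ?c f) x = f x"
          using x bb by (simp add: compose_def bij_betw_inv_into_right)
      qed (simp add: compose_extensional)
      then show "f \<in> ?F ` Hom G K" using Hom_compose[OF G f c] by force
    qed
  qed
  have rest: "restrict (?F f) H = compose H b h \<longleftrightarrow> restrict f H = h" if f: "f \<in> Hom G K" for f
  proof
    assume e: "restrict (?F f) H = compose H b h"
    show "restrict f H = h"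
    proof (rule extensionalityI[of _ H])
      fix x assume x: "x \<in> H"
      have "b (f x) = b (h x)"
        using fun_cong[OF e, of x] x H by (auto simp: compose_def)
      moreover have "f x \<in> carrier K" "h x \<in> carrier K"
        using f h x H by (auto simp: Hom_def hom_def)
      ultimately show "restrict f H x = h x" using inj x by (auto dest: inj_onD)
    qed (use h in auto)
  next
    assume e: "restrict f H = h"
    show "restrict (?F f) H = compose H b h"
      using H by (auto simp: e[symmetric] compose_def restrict_def fun_eq_iff)
  qed
  have "?F ` {f \<in> Hom G K. restrict f H = h} = {f \<in> Hom G K'. restrict f H = compose H b h}"
    unfolding surj[symmetric] using rest by auto
  moreover have "inj_on ?F {f \<in> Hom G K. restrict f H = h}"
    using injF by (rule inj_on_subset) auto
  ultimately show ?thesis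
    unfolding Pr_def using card_image[OF injF] surj
    by (metis (no_types, lifting) card_image)
qed

lemma measure_equivalence_all_finite_groups:
  fixes K :: "('k, 'n) monoid_scheme"
  assumes G: "group G" and m: "measure_equivalence G H1 H2 \<alpha>"
    and K: "group K" "finite (carrier K)" and h: "h \<in> Hom (G\<lparr>carrier := H2\<rparr>) K"
  shows "Pr G H2 K h = Pr G H1 K (compose H1 h \<alpha>)"
proof -
  obtain b :: "'k \<Rightarrow> nat" where inj: "inj_on b (carrier K)"
    using K(2) finite_imp_inj_to_nat_seg by blast
  define c where "c = inv_into (carrier K) b"
  define K' :: "nat monoid" where
    "K' = \<lparr>carrier = b ` carrier K, mult = (\<lambda>x y. b (c x \<otimes>\<^bsub>K\<^esub> c y)), one = b \<one>\<^bsub>K\<^esub>\<rparr>"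
  have cb: "c (b x) = x" if "x \<in> carrier K" for x
    using that inj by (simp add: c_def)
  interpret K: group K by fact
  have b: "b \<in> iso K K'"
    using inj by (auto simp: iso_def hom_def K'_def cb bij_betw_def)
  have "K' = K'\<lparr>one := b \<one>\<^bsub>K\<^esub>\<rparr>" by (simp add: K'_def)
  then have K': "group K'" "finite (carrier K')"
    using K.iso_imp_img_group[OF b] K(2) by (auto simp: K'_def)
  have H: "H1 \<subseteq> carrier G" "H2 \<subseteq> carrier G"
    using m by (auto simp: measure_equivalence_def fg_subgroup_def subgroup_def)
  have bh: "b \<in> hom K K'" using b by (simp add: iso_def)
  have H2: "group (G\<lparr>carrier := H2\<rparr>)"
    using m G by (auto simp: measure_equivalence_def fg_subgroup_def intro: subgroup.subgroup_is_group)
  have "compose H2 b h \<in> Hom (G\<lparr>carrier := H2\<rparr>) K'"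
    using Hom_compose[OF H2 h bh] by simp
  then have e: "Pr G H2 K' (compose H2 b h) = Pr G H1 K' (compose H1 (compose H2 b h) \<alpha>)"
    using m K' by (auto simp: measure_equivalence_def)
  have \<alpha>: "\<alpha> \<in> H1 \<rightarrow> H2"
    using m by (auto simp: measure_equivalence_def Iso_def iso_def hom_def)
  have h': "h \<in> H2 \<rightarrow> carrier K" "h \<in> extensional H2"
    using h by (auto simp: Hom_def hom_def)
  have "compose H1 (compose H2 b h) \<alpha> = compose H1 b (compose H1 h \<alpha>)"
    using \<alpha> by (auto simp: compose_def restrict_def fun_eq_iff Pi_iff)
  moreover have "Pr G H2 K' (compose H2 b h) = Pr G H2 K h"
    by (rule Pr_iso[OF G K(1) H(2) b h'])
  moreover have "Pr G H1 K' (compose H1 b (compose H1 h \<alpha>)) = Pr G H1 K (compose H1 h \<alpha>)"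
    by (rule Pr_iso[OF G K(1) H(1) b])
      (use \<alpha> h' in \<open>auto simp: compose_def Pi_iff\<close>)
  ultimately show ?thesis using e by simp
qed

end

theory Submission
  imports Defs
begin

text \<open>
  The identity \<open>Pr (h) = Pr (h \<circ> \<alpha>)\<close> defining a measure equivalence is preserved by inverting
  and composing \<open>\<alpha>\<close>, so the finitely generated subgroups of \<open>G\<close> and the measure equivalences
  between them form a groupoid (\<open>measure_equivalence_inverse\<close>,
  \<open>measure_equivalence_compose\<close>). Every automorphism of \<open>G\<close> restricts to an arrow of this
  groupoid, because precomposition with it permutes \<open>Hom(G, K)\<close>
  (\<open>measure_equivalence_restrict_auto\<close>).
  Profinite rigidity of \<open>H\<close> says that every arrow out of \<open>H\<close> is such a restriction. This gives
  both conditions: the first concerns the targets of these arrows, the second the loops at \<open>H\<close>.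
  Conversely, let \<open>\<alpha>: H \<rightarrow> L\<close> be an arrow. The first condition supplies an automorphism \<open>\<phi>\<close>
  with \<open>\<phi>(H) = L\<close>, and then \<open>(\<phi>|H)\<inverse> \<circ> \<alpha>\<close> is a loop at \<open>H\<close>. By the second condition it is
  the restriction of some \<open>\<psi>\<close> stabilising \<open>H\<close>, so \<open>\<alpha>\<close> is the restriction of \<open>\<phi> \<circ> \<psi>\<close>.
\<close>

lemma auto_eq_Iso: "auto G = Iso G G"
  by (auto simp: auto_def Iso_def iso_def Bij_def)

lemma Iso_inverse:
  assumes "group A" "\<alpha> \<in> Iso A B"
  shows "restrict (inv_into (carrier A) \<alpha>) (carrier B) \<in> Iso B A"
proof -
  have "inv_into (carrier A) \<alpha> \<in> iso B A"
    using assms by (auto simp: Iso_def intro: group.iso_set_sym)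
  \<comment> \<open>\<open>B\<close> inherits closure from \<open>A\<close>; hence the inverse is still multiplicative once it is cut
    off outside \<open>carrier B\<close>.\<close>
  moreover have "x \<otimes>\<^bsub>B\<^esub> y \<in> carrier B" if xy: "x \<in> carrier B" "y \<in> carrier B" for x y
  proof -
    have \<alpha>: "\<alpha> \<in> hom A B" "\<alpha> ` carrier A = carrier B"
      using assms(2) by (auto simp: Iso_def iso_def bij_betw_def)
    obtain a b where "x = \<alpha> a" "a \<in> carrier A" "y = \<alpha> b" "b \<in> carrier A"
      using xy \<alpha>(2) by blast
    then have "x \<otimes>\<^bsub>B\<^esub> y = \<alpha> (a \<otimes>\<^bsub>A\<^esub> b)" "a \<otimes>\<^bsub>A\<^esub> b \<in> carrier A"
      using \<alpha>(1) assms(1) by (auto simp: hom_def group_def monoid.m_closed)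
    then show ?thesis using \<alpha>(2) by auto
  qed
  ultimately show ?thesis
    by (auto simp: Iso_def iso_def hom_def cong: bij_betw_cong)
qed

lemma Iso_compose:
  assumes "group A" "\<alpha> \<in> Iso A B" "\<beta> \<in> Iso B C"
  shows "compose (carrier A) \<beta> \<alpha> \<in> Iso A C"
proof -
  have "compose (carrier A) \<beta> \<alpha> \<in> Hom A C"
    by (rule Hom_compose) (use assms in \<open>auto simp: Hom_def Iso_def iso_def\<close>)
  moreover have "bij_betw (compose (carrier A) \<beta> \<alpha>) (carrier A) (carrier C)"
    using assms by (auto simp: Iso_def iso_def intro: bij_betw_compose)
  ultimately show ?thesis by (auto simp: Hom_def Iso_def iso_def)
qed

lemma fg_subgroup_is_group:
  assumes "group G" "fg_subgroup H G"
  shows "group (G\<lparr>carrier := H\<rparr>)"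
  using assms by (auto simp: fg_subgroup_def intro: subgroup.subgroup_is_group)

lemma measure_equivalence_inverse:
  assumes G: "group G" and m: "measure_equivalence G H1 H2 \<alpha>"
  shows "measure_equivalence G H2 H1 (restrict (inv_into H1 \<alpha>) H2)"
proof -
  let ?\<beta> = "restrict (inv_into H1 \<alpha>) H2"
  have fg: "fg_subgroup H1 G" "fg_subgroup H2 G"
    and \<alpha>: "\<alpha> \<in> Iso (G\<lparr>carrier := H1\<rparr>) (G\<lparr>carrier := H2\<rparr>)"
    using m by (auto simp: measure_equivalence_def)
  have \<beta>: "?\<beta> \<in> Iso (G\<lparr>carrier := H2\<rparr>) (G\<lparr>carrier := H1\<rparr>)"
    using Iso_inverse[OF fg_subgroup_is_group[OF G fg(1)] \<alpha>] by simp
  have bij: "bij_betw \<alpha> H1 H2" using \<alpha> by (auto simp: Iso_def iso_def)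
  have "Pr G H1 K h = Pr G H2 K (compose H2 h ?\<beta>)"
    if K: "group K" "finite (carrier K)" and h: "h \<in> Hom (G\<lparr>carrier := H1\<rparr>) K"
    for K :: "nat monoid" and h
  proof -
    have "compose H2 h ?\<beta> \<in> Hom (G\<lparr>carrier := H2\<rparr>) K"
      using Hom_compose[OF fg_subgroup_is_group[OF G fg(2)], of ?\<beta> _ h K] \<beta> h
      by (auto simp: Hom_def Iso_def iso_def)
    then have "Pr G H2 K (compose H2 h ?\<beta>) = Pr G H1 K (compose H1 (compose H2 h ?\<beta>) \<alpha>)"
      using m K by (auto simp: measure_equivalence_def)
    moreover have "compose H1 (compose H2 h ?\<beta>) \<alpha> = h"
      using bij h
      by (auto simp: compose_def Hom_def extensional_def fun_eq_iff bij_betw_def)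
    ultimately show ?thesis by simp
  qed
  then show ?thesis using fg \<beta> by (auto simp: measure_equivalence_def)
qed

lemma measure_equivalence_compose:
  assumes G: "group G" and \<alpha>: "measure_equivalence G H1 H2 \<alpha>"
    and \<beta>: "measure_equivalence G H2 H3 \<beta>"
  shows "measure_equivalence G H1 H3 (compose H1 \<beta> \<alpha>)"
proof -
  have fg: "fg_subgroup H1 G" "fg_subgroup H2 G" "fg_subgroup H3 G"
    and iso: "\<alpha> \<in> Iso (G\<lparr>carrier := H1\<rparr>) (G\<lparr>carrier := H2\<rparr>)"
      "\<beta> \<in> Iso (G\<lparr>carrier := H2\<rparr>) (G\<lparr>carrier := H3\<rparr>)"
    using \<alpha> \<beta> by (auto simp: measure_equivalence_def)
  have "Pr G H3 K h = Pr G H1 K (compose H1 h (compose H1 \<beta> \<alpha>))"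
    if K: "group K" "finite (carrier K)" and h: "h \<in> Hom (G\<lparr>carrier := H3\<rparr>) K"
    for K :: "nat monoid" and h
  proof -
    have "compose H2 h \<beta> \<in> Hom (G\<lparr>carrier := H2\<rparr>) K"
      using Hom_compose[OF fg_subgroup_is_group[OF G fg(2)], of \<beta> _ h K] iso(2) h
      by (auto simp: Hom_def Iso_def iso_def)
    then have "Pr G H3 K h = Pr G H1 K (compose H1 (compose H2 h \<beta>) \<alpha>)"
      using \<alpha> \<beta> K h by (auto simp: measure_equivalence_def)
    moreover have "compose H1 (compose H2 h \<beta>) \<alpha> = compose H1 h (compose H1 \<beta> \<alpha>)"
      using iso(1) by (auto simp: Iso_def iso_def hom_def compose_def fun_eq_iff Pi_iff)
    ultimately show ?thesis by simp
  qed
  moreover have "compose H1 \<beta> \<alpha> \<in> Iso (G\<lparr>carrier := H1\<rparr>) (G\<lparr>carrier := H3\<rparr>)"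
    using Iso_compose[OF fg_subgroup_is_group[OF G fg(1)] iso] by simp
  ultimately show ?thesis using fg by (auto simp: measure_equivalence_def)
qed

lemma auto_restrict_Iso:
  assumes "group G" "\<phi> \<in> auto G" "subgroup H G"
  shows "restrict \<phi> H \<in> Iso (G\<lparr>carrier := H\<rparr>) (G\<lparr>carrier := \<phi> ` H\<rparr>)"
proof -
  have "H \<subseteq> carrier G" using assms(3) by (rule subgroup.subset)
  then show ?thesis
    using assms
    by (auto simp: Iso_def iso_def hom_def auto_def Bij_def bij_betw_def subset_iff
        subgroup.m_closed intro: inj_on_subset)
qed

lemma fg_subgroup_auto_image:
  assumes G: "group G" and \<phi>: "\<phi> \<in> auto G" and H: "fg_subgroup H G"
  shows "fg_subgroup (\<phi> ` H) G"
proof -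
  let ?A = "G\<lparr>carrier := H\<rparr>" and ?B = "G\<lparr>carrier := \<phi> ` H\<rparr>"
  have H': "subgroup H G" using H by (simp add: fg_subgroup_def)
  have "group_hom G G \<phi>"
    using G \<phi> by (auto simp: group_hom_def group_hom_axioms_def auto_def)
  then have sub: "subgroup (\<phi> ` H) G"
    using H' by (rule group_hom.subgroup_img_is_subgroup)
  obtain S where S: "finite S" "S \<subseteq> H" "generate ?A S = H"
    using H by (auto simp: fg_subgroup_def finitely_generated_def)
  interpret r: group_hom ?A ?B "restrict \<phi> H"
    using auto_restrict_Iso[OF G \<phi> H'] G H' sub
    by (auto simp: group_hom_def group_hom_axioms_def Iso_def iso_def
        intro: subgroup.subgroup_is_group)
  have "generate ?B (restrict \<phi> H ` S) = \<phi> ` H"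
    using r.generate_img[of S] S by simp
  then have "finitely_generated ?B"
    unfolding finitely_generated_def using S by (intro exI[of _ "restrict \<phi> H ` S"]) auto
  with sub show ?thesis by (simp add: fg_subgroup_def)
qed

text \<open>
  Precomposition with an automorphism permutes \<open>Hom(G, K)\<close>; its inverse is precomposition with
  the inverse automorphism.
\<close>

lemma bij_betw_Hom_precompose:
  assumes G: "group G" and \<phi>: "\<phi> \<in> auto G"
  shows "bij_betw (\<lambda>f. compose (carrier G) f \<phi>) (Hom G K) (Hom G K)"
proof -
  let ?\<psi> = "restrict (inv_into (carrier G) \<phi>) (carrier G)"
  have \<psi>: "?\<psi> \<in> auto G" using Iso_inverse[OF G] \<phi> by (auto simp: auto_eq_Iso)
  have pre: "compose (carrier G) f \<chi> \<in> Hom G K" if "\<chi> \<in> auto G" "f \<in> Hom G K" for f \<chi>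
    using Hom_compose[OF G, of \<chi> G f K] that by (auto simp: Hom_def auto_def Bij_def)
  have bij: "bij_betw \<phi> (carrier G) (carrier G)" using \<phi> by (auto simp: auto_def Bij_def)
  have "\<phi> \<in> carrier G \<rightarrow> carrier G" "?\<psi> \<in> carrier G \<rightarrow> carrier G"
    using \<phi> \<psi> by (auto simp: auto_def hom_def)
  then have "compose (carrier G) (compose (carrier G) f \<phi>) ?\<psi> = f"
    "compose (carrier G) (compose (carrier G) f ?\<psi>) \<phi> = f" if "f \<in> Hom G K" for f
    using that bij
    by (auto simp: compose_def Hom_def extensional_def fun_eq_iff bij_betw_inv_into_left
        bij_betw_inv_into_right Pi_iff)
  then show ?thesis
    using pre \<phi> \<psi> by (intro bij_betw_byWitness[where f' = "\<lambda>f. compose (carrier G) f ?\<psi>"]) auto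
qed

text \<open>
  Precomposition with \<open>\<phi>\<close> matches the extensions of \<open>h\<close> from \<open>\<phi>(H)\<close> with the extensions of
  \<open>h \<circ> \<phi>|H\<close> from \<open>H\<close>, so the two are equally numerous.
\<close>

lemma Pr_auto_image:
  assumes G: "group G" and \<phi>: "\<phi> \<in> auto G" and H: "H \<subseteq> carrier G"
    and h: "h \<in> extensional (\<phi> ` H)"
  shows "Pr G (\<phi> ` H) K h = Pr G H K (compose H h (restrict \<phi> H))"
proof -
  let ?P = "\<lambda>f. compose (carrier G) f \<phi>"
  let ?A = "{f \<in> Hom G K. restrict f (\<phi> ` H) = h}"
  let ?B = "{f \<in> Hom G K. restrict f H = compose H h (restrict \<phi> H)}"
  have bij: "bij_betw ?P (Hom G K) (Hom G K)" by (rule bij_betw_Hom_precompose[OF G \<phi>])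
  have rest: "restrict (?P f) H = compose H h (restrict \<phi> H) \<longleftrightarrow> restrict f (\<phi> ` H) = h" for f
  proof -
    have "restrict (?P f) H = compose H h (restrict \<phi> H) \<longleftrightarrow> (\<forall>x\<in>H. f (\<phi> x) = h (\<phi> x))"
      using H by (auto simp: compose_def restrict_def fun_eq_iff subset_iff)
    also have "\<dots> \<longleftrightarrow> restrict f (\<phi> ` H) = h"
      using h by (auto simp: restrict_def fun_eq_iff extensional_def)
    finally show ?thesis .
  qed
  have "?P ` ?A = ?B"
    using bij_betw_imp_surj_on[OF bij] rest by (auto simp: set_eq_iff image_iff) (metis (lifting))+
  moreover have "inj_on ?P ?A"
    by (rule inj_on_subset[OF bij_betw_imp_inj_on[OF bij]]) auto
  ultimately have "card ?A = card ?B" by (metis (no_types, lifting) card_image)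
  then show ?thesis by (simp add: Pr_def)
qed

lemma measure_equivalence_restrict_auto:
  assumes G: "group G" and \<phi>: "\<phi> \<in> auto G" and H: "fg_subgroup H G"
  shows "measure_equivalence G H (\<phi> ` H) (restrict \<phi> H)"
proof -
  have H': "subgroup H G" using H by (simp add: fg_subgroup_def)
  have "Pr G (\<phi> ` H) K h = Pr G H K (compose H h (restrict \<phi> H))"
    if "h \<in> Hom (G\<lparr>carrier := \<phi> ` H\<rparr>) K" for K :: "nat monoid" and h
    by (rule Pr_auto_image[OF G \<phi> subgroup.subset[OF H']]) (use that in \<open>simp add: Hom_def\<close>)
  then show ?thesis
    using H fg_subgroup_auto_image[OF G \<phi> H] auto_restrict_Iso[OF G \<phi> H']
    by (simp add: measure_equivalence_def)
qed

theorem theorem1p6: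
  fixes G :: "('a, 'm) monoid_scheme" and H :: "'a set"
  assumes "group G" and "finitely_generated G"
    and "subgroup H G" and "finitely_generated (G\<lparr>carrier := H\<rparr>)"
  shows "profinitely_rigid G H \<longleftrightarrow>
    setwise_profinitely_rigid G H \<and> MP G H = rho H ` Stab G H"
proof
  note G = \<open>group G\<close>
  have H: "fg_subgroup H G" using assms by (simp add: fg_subgroup_def)
  have MP: "MP G H = {\<gamma>. measure_equivalence G H H \<gamma>}"
    by (auto simp: MP_def auto_eq_Iso measure_equivalence_def)
  {
    assume rigid: "profinitely_rigid G H"
    have "setwise_profinitely_rigid G H"
      unfolding setwise_profinitely_rigid_def
    proof (intro allI impI)
      fix L assume "fg_subgroup L G \<and> measure_equivalent G L H"
      then obtain \<alpha> where L: "fg_subgroup L G" and "measure_equivalence G L H \<alpha>"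
        by (auto simp: measure_equivalent_def)
      then have "measure_equivalence G H L (restrict (inv_into L \<alpha>) H)"
        by (intro measure_equivalence_inverse[OF G])
      with rigid L show "\<exists>\<phi>\<in>auto G. L = \<phi> ` H"
        unfolding profinitely_rigid_def by blast
    qed
    moreover have "MP G H \<subseteq> rho H ` Stab G H"
      using rigid H unfolding profinitely_rigid_def MP rho_def Stab_def by blast
    moreover have "rho H ` Stab G H \<subseteq> MP G H"
      using measure_equivalence_restrict_auto[OF G _ H] by (force simp: MP rho_def Stab_def)
    ultimately show "setwise_profinitely_rigid G H \<and> MP G H = rho H ` Stab G H" by blast
  next
    assume *: "setwise_profinitely_rigid G H \<and> MP G H = rho H ` Stab G H"
    show "profinitely_rigid G H"
      unfolding profinitely_rigid_def
    proof (intro allI impI)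
      fix L \<alpha> assume "fg_subgroup L G \<and> measure_equivalence G H L \<alpha>"
      then have L: "fg_subgroup L G" and \<alpha>: "measure_equivalence G H L \<alpha>" by auto
      have "measure_equivalent G L H"
        using measure_equivalence_inverse[OF G \<alpha>] by (auto simp: measure_equivalent_def)
      then obtain \<phi> where \<phi>: "\<phi> \<in> auto G" "L = \<phi> ` H"
        using * L by (auto simp: setwise_profinitely_rigid_def)
      define \<beta> where "\<beta> = restrict (inv_into H (restrict \<phi> H)) L"
      have "measure_equivalence G L H \<beta>"
        using measure_equivalence_inverse[OF G measure_equivalence_restrict_auto[OF G \<phi>(1) H]]
        by (simp add: \<phi>(2) \<beta>_def)
      then have "compose H \<beta> \<alpha> \<in> MP G H"
        using measure_equivalence_compose[OF G \<alpha>] by (simp add: MP)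
      then obtain \<psi> where \<psi>: "\<psi> \<in> auto G" "\<psi> ` H = H" "restrict \<psi> H = compose H \<beta> \<alpha>"
        using * by (auto simp: rho_def Stab_def)
      let ?\<chi> = "compose (carrier G) \<phi> \<psi>"
      have HG: "H \<subseteq> carrier G" using assms(3) by (rule subgroup.subset)
      have \<alpha>': "\<alpha> \<in> H \<rightarrow> L" "\<alpha> \<in> extensional H"
        using \<alpha> by (auto simp: measure_equivalence_def Iso_def iso_def hom_def)
      have "?\<chi> \<in> auto G"
        using Iso_compose[OF G] \<phi>(1) \<psi>(1) by (simp add: auto_eq_Iso)
      moreover have "?\<chi> ` H = L"
      proof -
        have "?\<chi> ` H = \<phi> ` \<psi> ` H"
          using HG by (auto simp: compose_def image_image subset_iff intro!: image_cong)
        then show ?thesis by (simp add: \<psi>(2) \<phi>(2))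
      qed
      moreover have "restrict ?\<chi> H = \<alpha>"
      proof (rule extensionalityI[of _ H])
        fix x assume x: "x \<in> H"
        have ax: "\<alpha> x \<in> restrict \<phi> H ` H" using \<alpha>'(1) x \<phi>(2) by (auto simp: Pi_iff)
        have "\<psi> x = \<beta> (\<alpha> x)" using fun_cong[OF \<psi>(3), of x] x by (simp add: compose_def)
        also have "\<dots> = inv_into H (restrict \<phi> H) (\<alpha> x)"
          using \<alpha>'(1) x by (auto simp: \<beta>_def)
        finally have "\<phi> (\<psi> x) = \<alpha> x"
          using f_inv_into_f[OF ax] inv_into_into[OF ax] by simp
        then show "restrict ?\<chi> H x = \<alpha> x" using x HG by (auto simp: compose_def)
      qed (use \<alpha>'(2) in auto)
      ultimately show "\<exists>\<phi>\<in>auto G. \<phi> ` H = L \<and> restrict \<phi> H = \<alpha>" by blast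
    qed
  }
qed

end
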